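(* Let $r\ge 1$ and let $T:S_n(\mathbb{R})\to S_n(\mathbb{R})$ be a linear transformation of the form $T(A)=\sum_{k=1}^r\operatorname{tr}(AB_k)U_k$, where $B_k\in S_n(\mathbb{R})$ and $U_k\in S_n(\mathbb{R})$ is positive definite for $k=1,\ldots,r$. If $B_k$ is positive semi-definite and non-zero for every $k=1,2,\ldots,r$, then $T$ is positive definite preserving.
   Context: $S_n(\mathbb{R})$ is the real vector space of real symmetric $n\times n$ matrices. A linear transformation $T:S_n(\mathbb{R})\to S_n(\mathbb{R})$ is called positive definite preserving if $T(A)$ is positive definite whenever $A\in S_n(\mathbb{R})$ is positive definite. *)

theory Defs
  imports "HOL-Analysis.Analysis"
begin

definition symmetric_matrices :: "(real ^ 'n ^ 'n) set" where
  "symmetric_matrices = {A. transpose A = A}"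

lemma subspace_symmetric_matrices: "subspace symmetric_matrices"
  unfolding symmetric_matrices_def subspace_def
  by (simp add: transpose_def vec_eq_iff)

definition positive_definite :: "real ^ 'n ^ 'n \<Rightarrow> bool" where
  "positive_definite A \<longleftrightarrow>
     A \<in> symmetric_matrices \<and> (\<forall>x. x \<noteq> 0 \<longrightarrow> x \<bullet> (A *v x) > 0)"

definition positive_semidefinite :: "real ^ 'n ^ 'n \<Rightarrow> bool" where
  "positive_semidefinite A \<longleftrightarrow>
     A \<in> symmetric_matrices \<and> (\<forall>x. x \<bullet> (A *v x) \<ge> 0)"

(* A transformation of the space of symmetric matrices is represented by a function on all
   square matrices of which only the values on symmetric matrices matter; those values are
   required to be symmetric again. *)

definition linear_on_symmetric :: "(real ^ 'n ^ 'n \<Rightarrow> real ^ 'n ^ 'n) \<Rightarrow> bool" where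
  "linear_on_symmetric T \<longleftrightarrow>
     T \<in> symmetric_matrices \<rightarrow> symmetric_matrices \<and>
     (\<forall>A\<in>symmetric_matrices. \<forall>B\<in>symmetric_matrices. T (A + B) = T A + T B) \<and>
     (\<forall>c. \<forall>A\<in>symmetric_matrices. T (c *\<^sub>R A) = c *\<^sub>R T A)"

definition positive_definite_preserving :: "(real ^ 'n ^ 'n \<Rightarrow> real ^ 'n ^ 'n) \<Rightarrow> bool" where
  "positive_definite_preserving T \<longleftrightarrow>
     (\<forall>A\<in>symmetric_matrices. positive_definite A \<longrightarrow> positive_definite (T A))"

end

theory Submission
  imports Defs
begin

text \<open>
  Everything reduces to \<open>trace (A ** B) > 0\<close> for \<open>A\<close> positive definite and \<open>B \<noteq> 0\<close> positive
  semidefinite. No spectral theorem is needed: if \<open>v = B x \<noteq> 0\<close> then \<open>d = x \<bullet> B x > 0\<close>, the Schur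
  complement \<open>B - v v\<^sup>T / d\<close> is again positive semidefinite, and passing to it lowers the trace by
  \<open>(v \<bullet> A v) / d > 0\<close>. Taking \<open>x\<close> to be a coordinate vector, this kills one more column of \<open>B\<close>.
\<close>

definition outer_square :: "real ^ 'n \<Rightarrow> real ^ 'n ^ 'n" where
  "outer_square v = (\<chi> i j. v $ i * v $ j)"

lemma outer_square_vector: "outer_square v *v x = (v \<bullet> x) *\<^sub>R v"
  by (simp add: outer_square_def matrix_vector_mult_def vec_eq_iff inner_vec_def
      sum_distrib_left mult_ac)

lemma outer_square_symmetric: "outer_square v \<in> symmetric_matrices"
  by (simp add: outer_square_def symmetric_matrices_def transpose_def vec_eq_iff)

text \<open>This turns the trace lost in passing to the Schur complement into a value of the
  quadratic form of \<open>A\<close>, so that positive definiteness applies.\<close>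

lemma trace_mult_outer_square: "trace (A ** outer_square v) = v \<bullet> (A *v v)"
  by (simp add: outer_square_def trace_def matrix_matrix_mult_def matrix_vector_mult_def
      inner_vec_def sum_distrib_left mult_ac)

lemma trace_mult_add_scaleR:
  fixes A B C :: "real ^ 'n ^ 'n"
  shows "trace (A ** (B + c *\<^sub>R C)) = trace (A ** B) + c * trace (A ** C)"
  by (simp add: trace_def matrix_matrix_mult_def algebra_simps sum.distrib sum_distrib_left)

lemma matrix_vector_mult_sum_left:
  fixes M :: "'i \<Rightarrow> real ^ 'n ^ 'm"
  shows "(\<Sum>i\<in>I. M i) *v x = (\<Sum>i\<in>I. M i *v x)"
  by (induction I rule: infinite_finite_induct) (simp_all add: matrix_vector_mult_add_rdistrib)

lemma symmetric_inner_matrix: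
  assumes "B \<in> symmetric_matrices"
  shows "x \<bullet> (B *v y) = y \<bullet> (B *v x)"
  using assms dot_lmul_matrix[of x B y]
  by (simp add: symmetric_matrices_def inner_commute flip: transpose_matrix_vector)

text \<open>On the line through \<open>B *v x\<close> with direction \<open>x\<close> the quadratic
  form has no quadratic term, so it is affine with slope twice the squared norm of
  \<open>B *v x\<close>. A nonconstant affine function takes negative values.\<close>

lemma positive_semidefinite_null_vector:
  fixes B :: "real ^ 'n ^ 'n"
  assumes B: "positive_semidefinite B" and x: "x \<bullet> (B *v x) = 0"
  shows "B *v x = 0"
proof (rule ccontr)
  assume nz: "B *v x \<noteq> 0"
  define y where "y = B *v x"
  \<comment> \<open>Solves
    \<open>y \<bullet> (B *v y) + 2 * t * (y \<bullet> y) = -1\<close>.\<close>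
  define t where "t = - (y \<bullet> (B *v y) + 1) / (2 * (y \<bullet> y))"
  have yy: "y \<bullet> y > 0" using nz by (simp add: y_def)
  have sym: "x \<bullet> (B *v y) = y \<bullet> y"
    using symmetric_inner_matrix[of B x y] B by (simp add: positive_semidefinite_def y_def)
  have "0 \<le> (y + t *\<^sub>R x) \<bullet> (B *v (y + t *\<^sub>R x))"
    using B by (simp add: positive_semidefinite_def)
  also have "\<dots> = y \<bullet> (B *v y) + 2 * t * (y \<bullet> y)"
    using x sym by (simp add: matrix_vector_right_distrib matrix_vector_mult_scaleR inner_add_left
        inner_add_right flip: y_def)
  also have "\<dots> = -1" using yy by (simp add: t_def field_simps)
  finally show False by simp
qed

text \<open>Completing the square: the form of the complement at \<open>y\<close> is the minimum
  over \<open>t\<close> of the form of \<open>B\<close> at \<open>y - t *\<^sub>R x\<close>, hence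
  nonnegative.\<close>

lemma positive_semidefinite_Schur_complement:
  fixes B :: "real ^ 'n ^ 'n"
  assumes B: "positive_semidefinite B" and d: "x \<bullet> (B *v x) > 0"
  shows "positive_semidefinite (B - (1 / (x \<bullet> (B *v x))) *\<^sub>R outer_square (B *v x))"
    (is "positive_semidefinite (B - (1 / ?d) *\<^sub>R _)")
proof -
  have Bs: "B \<in> symmetric_matrices" using B by (simp add: positive_semidefinite_def)
  have "0 \<le> y \<bullet> ((B - (1 / ?d) *\<^sub>R outer_square (B *v x)) *v y)" for y
  proof -
    define c where "c = y \<bullet> (B *v x)"
    \<comment> \<open>The minimizer of the quadratic polynomial in \<open>t\<close> expanded
      below.\<close>
    define t where "t = c / ?d"
    have c': "x \<bullet> (B *v y) = c"
      using symmetric_inner_matrix[OF Bs] by (simp add: c_def)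
    have "0 \<le> (y - t *\<^sub>R x) \<bullet> (B *v (y - t *\<^sub>R x))"
      using B by (simp add: positive_semidefinite_def)
    also have "\<dots> = y \<bullet> (B *v y) - 2 * t * c + t * (t * ?d)"
      by (simp add: matrix_vector_mult_diff_distrib matrix_vector_mult_scaleR inner_diff_left
          inner_diff_right c' algebra_simps flip: c_def)
    also have "\<dots> = y \<bullet> (B *v y) - c * c / ?d"
      using d by (simp add: t_def)
    also have "\<dots> = y \<bullet> ((B - (1 / ?d) *\<^sub>R outer_square (B *v x)) *v y)"
      by (simp add: matrix_vector_mult_diff_rdistrib outer_square_vector inner_diff_right
          inner_commute[of "B *v x" y] flip: c_def scaleR_matrix_vector_assoc)
    finally show ?thesis .
  qed
  then show ?thesis
    unfolding positive_semidefinite_def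
    by (auto intro!: subspace_diff subspace_scale subspace_symmetric_matrices Bs
        outer_square_symmetric)
qed

lemma trace_mult_positive:
  fixes A B :: "real ^ 'n ^ 'n"
  assumes A: "positive_definite A" and B: "positive_semidefinite B" "B \<noteq> 0"
  shows "trace (A ** B) > 0"
  using B
\<comment> \<open>The measure counts the nonzero columns of \<open>B\<close>.\<close>
proof (induction "card {j. B *v axis j 1 \<noteq> 0}" arbitrary: B rule: less_induct)
  case less
  obtain i where i: "B *v axis i 1 \<noteq> 0"
    using less.prems(2) by (auto simp: vec_eq_iff matrix_vector_mult_basis column_def)
  define v where "v = B *v axis i 1"
  define d where "d = axis i 1 \<bullet> v"
  define B' where "B' = B - (1 / d) *\<^sub>R outer_square v"
  have Bs: "B \<in> symmetric_matrices" using less.prems by (simp add: positive_semidefinite_def)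
  \<comment> \<open>If \<open>d\<close> vanished, the null vector lemma would make column
    \<open>i\<close> zero.\<close>
  have d: "d > 0"
    using i less.prems(1) positive_semidefinite_null_vector[OF less.prems(1), of "axis i 1"]
    by (force simp: d_def v_def positive_semidefinite_def order_less_le)
  have B': "positive_semidefinite B'"
    using positive_semidefinite_Schur_complement[OF less.prems(1), of "axis i 1"] d
    by (simp add: B'_def d_def v_def)
  \<comment> \<open>The right-hand side depends on \<open>y\<close> only through
    \<open>B *v y\<close>, so zero columns of \<open>B\<close> stay zero in \<open>B'\<close>; for
    \<open>y = axis i 1\<close> the coefficient of \<open>v\<close> is 1 and column \<open>i\<close>
    cancels.\<close>
  have act: "B' *v y = B *v y - ((axis i 1 \<bullet> (B *v y)) / d) *\<^sub>R v" for y
  proof -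
    have "v \<bullet> y = axis i 1 \<bullet> (B *v y)"
      using symmetric_inner_matrix[OF Bs] by (simp add: v_def inner_commute)
    then show ?thesis
      by (simp add: B'_def matrix_vector_mult_diff_rdistrib outer_square_vector
          flip: scaleR_matrix_vector_assoc)
  qed
  have "B' *v axis i 1 = 0"
    using act[of "axis i 1"] d by (simp flip: v_def d_def)
  moreover have "B' *v axis j 1 = 0" if "B *v axis j 1 = 0" for j
    using that by (simp add: act)
  ultimately have "{j. B' *v axis j 1 \<noteq> 0} \<subset> {j. B *v axis j 1 \<noteq> 0}"
    using i by blast
  then have "card {j. B' *v axis j 1 \<noteq> 0} < card {j. B *v axis j 1 \<noteq> 0}"
    by (intro psubset_card_mono) auto
  \<comment> \<open>The complement may be zero, where the induction hypothesis is silent and the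
    trace is 0. The weak bound suffices, since the rank-one term is strictly positive.\<close>
  with less.hyps B' have "trace (A ** B') \<ge> 0"
    by (cases "B' = 0") (auto simp: less_imp_le trace_def)
  moreover have "B = B' + (1 / d) *\<^sub>R outer_square v" by (simp add: B'_def)
  then have "trace (A ** B) = trace (A ** B') + (v \<bullet> (A *v v)) / d"
    using trace_mult_add_scaleR[of A B' "1 / d" "outer_square v"]
    by (simp add: trace_mult_outer_square)
  moreover have "v \<bullet> (A *v v) > 0"
    using A i by (simp add: positive_definite_def v_def)
  ultimately show ?case using d by (simp add: add_nonneg_pos)
qed

theorem theorem3p4:
  fixes T :: "real ^ 'n ^ 'n \<Rightarrow> real ^ 'n ^ 'n"
    and B U :: "nat \<Rightarrow> real ^ 'n ^ 'n"
    and r :: nat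
  assumes "r \<ge> 1"
    and "linear_on_symmetric T"
    and "\<And>A. A \<in> symmetric_matrices \<Longrightarrow> T A = (\<Sum>k=1..r. trace (A ** B k) *\<^sub>R U k)"
    and "\<And>k. k \<in> {1..r} \<Longrightarrow> B k \<in> symmetric_matrices"
    and "\<And>k. k \<in> {1..r} \<Longrightarrow> U k \<in> symmetric_matrices \<and> positive_definite (U k)"
    and "\<And>k. k \<in> {1..r} \<Longrightarrow> positive_semidefinite (B k) \<and> B k \<noteq> 0"
  shows "positive_definite_preserving T"
  unfolding positive_definite_preserving_def
proof (intro ballI impI)
  fix A :: "real ^ 'n ^ 'n"
  assume A: "A \<in> symmetric_matrices" "positive_definite A"
  have tr: "trace (A ** B k) > 0" if "k \<in> {1..r}" for k
    using trace_mult_positive A(2) assms(6)[OF that] by blast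
  have "x \<bullet> (T A *v x) > 0" if "x \<noteq> 0" for x
  proof -
    have "x \<bullet> (T A *v x) = (\<Sum>k=1..r. trace (A ** B k) * (x \<bullet> (U k *v x)))"
      by (simp add: assms(3)[OF A(1)] matrix_vector_mult_sum_left inner_sum_right
          flip: scaleR_matrix_vector_assoc)
    \<comment> \<open>Every summand is positive, and \<open>r \<ge> 1\<close> makes the index set
      nonempty.\<close>
    also have "\<dots> > 0"
      using tr assms(1) assms(5) that
      by (intro sum_pos) (auto simp: positive_definite_def)
    finally show ?thesis .
  qed
  moreover have "T A \<in> symmetric_matrices"
    using assms(2) A(1) by (auto simp: linear_on_symmetric_def)
  ultimately show "positive_definite (T A)"
    by (simp add: positive_definite_def)
qed

end
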